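(* Given sets of correct and faulty servers, $\mathbf{V}_{\mathrm{ok}}$ and $\mathbf{V}_{\mathrm{bad}}$, let $\{\mathcal{S}_v\}_{v\in\mathbf{V}_{\mathrm{ok}}}$ be a subjective federated Byzantine quorum system with quorum intersection and at least one intact server. Then the Stellar broadcast over this system implements weakly reliable Byzantine broadcast (Validity for intact servers, No duplication, Integrity, Consistency, and Totality for intact servers).
   Context: System model. There is a set of clients $\mathbf{C}$ and a disjoint finite non-empty set of servers $\mathbf{V}=\mathbf{V}_{\mathrm{ok}}\uplus\mathbf{V}_{\mathrm{bad}}$, with $\mathbf{V}_{\mathrm{ok}}$ the correct and $\mathbf{V}_{\mathrm{bad}}$ the faulty servers. Correct nodes follow their protocol; faulty (Byzantine) nodes behave arbitrarily. One distinguished client $c$ is the sender; it may be correct or faulty. Any two nodes communicate over an asynchronous point-to-point channel. If both endpoints are correct, the channel is authenticated and reliable: a correct node receives (eventually, after an arbitrary finite delay) a message from another correct node if and only if the latter sent it. Servers also send messages to themselves. Executions are complete: a handler of a correct server that stays enabled is eventually executed. A correct sender broadcasts at most one value. Federated Byzantine quorum system (FBQS) over $\mathbf{V}$: a function $\mathcal{S}$ assigning to each $v\in\mathbf{V}$ a non-empty set $\mathcal{S}(v)\subseteq 2^{\mathbf{V}}$ of quorum slices, with $v\in q$ for all $q\in\mathcal{S}(v)$. A non-empty $U\subseteq\mathbf{V}$ is a quorum in $\mathcal{S}$ if $\forall v\in U.\ \exists q\in\mathcal{S}(v).\ q\subseteq U$. $\mathcal{S}$ has quorum intersection if any two of its quorums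 intersect. For $I\subseteq\mathbf{V}$, $\mathcal{S}|_I$ is the FBQS over universe $I$ with $\mathcal{S}|_I(v)=\{q\cap I\mid q\in\mathcal{S}(v)\}$. Subjective FBQS: a family $\{\mathcal{S}_v\}_{v\in\mathbf{V}_{\mathrm{ok}}}$ of FBQSes over $\mathbf{V}$ such that $\mathcal{S}_{v_1}(v)=\mathcal{S}_{v_2}(v)$ for all $v_1,v_2,v\in\mathbf{V}_{\mathrm{ok}}$. It has quorum intersection if every $\mathcal{S}_v$ does. Let $\mathcal{Q}_v$ be the set of quorums in $\mathcal{S}_v$ (quorums known by $v$). The set $\mathbf{V}_{\mathrm{int}}$ of intact servers in $\{\mathcal{S}_v\}_{v\in\mathbf{V}_{\mathrm{ok}}}$ is the biggest set such that $\mathbf{V}_{\mathrm{int}}\cap\mathbf{V}_{\mathrm{bad}}=\emptyset$; if $\mathbf{V}_{\mathrm{int}}$ is non-empty then it is a quorum in $\mathcal{S}_v$ for each $v\in\mathbf{V}_{\mathrm{ok}}$; and $\mathcal{S}_v|_{\mathbf{V}_{\mathrm{int}}}$ has quorum intersection for each $v\in\mathbf{V}_{\mathrm{ok}}$. (Under quorum intersection this set exists and is unique.) For $v\in\mathbf{V}_{\mathrm{ok}}$, a set $B\subseteq\mathbf{V}$ is $v$-blocking if $q\cap B\neq\emptyset$ for every $q\in\mathcal{S}_v(v)$. Stellar broadcast over $\{\mathcal{S}_v\}_{v\in\mathbf{V}_{\mathrm{ok}}}$. To broadcast a value $a$, the sender $c$ sends $\mathtt{BCAST}(a)$ to every server.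 Each correct server $v$ has Boolean variables echoed, ready, delivered, all initially false, and the following handlers. (1) When $v$ has received $\mathtt{BCAST}(a)$ from $c$ and echoed is false: set echoed to true and send $\mathtt{ECHO}(a)$ to every server. (2) When $v$ has received $\mathtt{ECHO}(a)$ from every $u\in U$ for some $U\in\mathcal{Q}_v$ such that $v\in U$, and ready is false: set ready to true and send $\mathtt{READY}(a)$ to every server. (3) When $v$ has received $\mathtt{READY}(a)$ from every $u\in B$ for some non-empty $v$-blocking $B\subseteq\mathbf{V}$, and ready is false: set ready to true and send $\mathtt{READY}(a)$ to every server. (4) When $v$ has received $\mathtt{READY}(a)$ from every $u\in U$ for some $U\in\mathcal{Q}_v$ such that $v\in U$, and delivered is false: set delivered to true and deliver $a$. Weakly reliable Byzantine broadcast. Validity for intact servers: if the sender is correct and broadcasts a value $a$, then every intact server eventually delivers $a$. No duplication: every correct server delivers at most one value. Integrity: if some correct server delivers a value $a$ and the sender is correct, then $a$ was previously broadcast by the sender. Consistency: if some correct server delivers $a$ and another correct server delivers $a'$, then $a=a'$. Totality for intact servers: if a correct server delivers a value, then every intact server eventually delivers a value. *)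

theory Defs
  imports Main
begin

section \<open>Federated Byzantine quorum systems\<close>

definition fbqs :: "'n set \<Rightarrow> ('n \<Rightarrow> 'n set set) \<Rightarrow> bool" where
  "fbqs V S \<longleftrightarrow> (\<forall>v\<in>V. S v \<noteq> {} \<and> (\<forall>q\<in>S v. q \<subseteq> V \<and> v \<in> q))"

definition quorum :: "'n set \<Rightarrow> ('n \<Rightarrow> 'n set set) \<Rightarrow> 'n set \<Rightarrow> bool" where
  "quorum V S U \<longleftrightarrow> U \<noteq> {} \<and> U \<subseteq> V \<and> (\<forall>v\<in>U. \<exists>q\<in>S v. q \<subseteq> U)"

definition quorum_intersection :: "'n set \<Rightarrow> ('n \<Rightarrow> 'n set set) \<Rightarrow> bool" where
  "quorum_intersection V S \<longleftrightarrow>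
     (\<forall>U U'. quorum V S U \<and> quorum V S U' \<longrightarrow> U \<inter> U' \<noteq> {})"

text \<open>The restriction of \<open>S\<close> to \<open>I\<close>, to be read over the universe \<open>I\<close>.\<close>

definition fbqs_restrict :: "('n \<Rightarrow> 'n set set) \<Rightarrow> 'n set \<Rightarrow> 'n \<Rightarrow> 'n set set" where
  "fbqs_restrict S I v = {q \<inter> I |q. q \<in> S v}"

text \<open>
  Subjective systems: \<open>S v\<close> is the system in the view of the correct server \<open>v\<close>, so
  \<open>S v u\<close> are the slices that \<open>v\<close> attributes to \<open>u\<close>. Only views of correct servers matter.
\<close>

definition subjective_fbqs :: "'n set \<Rightarrow> 'n set \<Rightarrow> ('n \<Rightarrow> 'n \<Rightarrow> 'n set set) \<Rightarrow> bool" where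
  "subjective_fbqs Vok Vbad S \<longleftrightarrow>
     (\<forall>v\<in>Vok. fbqs (Vok \<union> Vbad) (S v)) \<and>
     (\<forall>v1\<in>Vok. \<forall>v2\<in>Vok. \<forall>v\<in>Vok. S v1 v = S v2 v)"

definition subjective_quorum_intersection ::
    "'n set \<Rightarrow> 'n set \<Rightarrow> ('n \<Rightarrow> 'n \<Rightarrow> 'n set set) \<Rightarrow> bool" where
  "subjective_quorum_intersection Vok Vbad S \<longleftrightarrow>
     (\<forall>v\<in>Vok. quorum_intersection (Vok \<union> Vbad) (S v))"

definition intact_candidate ::
    "'n set \<Rightarrow> 'n set \<Rightarrow> ('n \<Rightarrow> 'n \<Rightarrow> 'n set set) \<Rightarrow> 'n set \<Rightarrow> bool" where
  "intact_candidate Vok Vbad S I \<longleftrightarrow>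
     I \<subseteq> Vok \<union> Vbad \<and>
     I \<inter> Vbad = {} \<and>
     (I \<noteq> {} \<longrightarrow> (\<forall>v\<in>Vok. quorum (Vok \<union> Vbad) (S v) I)) \<and>
     (\<forall>v\<in>Vok. quorum_intersection I (fbqs_restrict (S v) I))"

text \<open>
  Biggest with respect to inclusion; the biggest candidate exists whenever \<open>S\<close> is a
  subjective system with quorum intersection.
\<close>

definition intact :: "'n set \<Rightarrow> 'n set \<Rightarrow> ('n \<Rightarrow> 'n \<Rightarrow> 'n set set) \<Rightarrow> 'n set" where
  "intact Vok Vbad S = (GREATEST I. intact_candidate Vok Vbad S I)"

definition blocking :: "('n \<Rightarrow> 'n \<Rightarrow> 'n set set) \<Rightarrow> 'n \<Rightarrow> 'n set \<Rightarrow> bool" where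
  "blocking S v B \<longleftrightarrow> (\<forall>q\<in>S v v. q \<inter> B \<noteq> {})"

section \<open>System model\<close>

record 'n network =
  clients :: "'n set"
  ok_clients :: "'n set"
  ok_servers :: "'n set"
  bad_servers :: "'n set"
  sender :: "'n"

definition servers :: "'n network \<Rightarrow> 'n set" where
  "servers N = ok_servers N \<union> bad_servers N"

definition ok_nodes :: "'n network \<Rightarrow> 'n set" where
  "ok_nodes N = ok_servers N \<union> ok_clients N"

definition sender_ok :: "'n network \<Rightarrow> bool" where
  "sender_ok N \<longleftrightarrow> sender N \<in> ok_clients N"

definition network_model :: "'n network \<Rightarrow> bool" where
  "network_model N \<longleftrightarrow>
     finite (servers N) \<and> servers N \<noteq> {} \<and>
     ok_servers N \<inter> bad_servers N = {} \<and>
     clients N \<inter> servers N = {} \<and>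
     ok_clients N \<subseteq> clients N \<and>
     sender N \<in> clients N"

section \<open>Stellar broadcast\<close>

datatype 'a msg = BCAST 'a | ECHO 'a | READY 'a

text \<open>
  \<open>Receive v u m\<close>: server \<open>v\<close> receives \<open>m\<close> on its channel from \<open>u\<close>.
  \<open>Echo\<close>, \<open>ReadyQuorum\<close>, \<open>ReadyBlocking\<close>, \<open>Deliver\<close> are the executions of the four handlers.
  \<open>Idle\<close> covers everything that does not affect correct nodes, and pads finite executions
  to infinite ones.
\<close>

datatype ('n, 'a) event =
    Broadcast 'a
  | Receive 'n 'n "'a msg"
  | Echo 'n 'a
  | ReadyQuorum 'n 'a
  | ReadyBlocking 'n 'a
  | Deliver 'n 'a
  | Idle

text \<open>
  \<open>(u, v, m) \<in> sent s\<close>: the correct node \<open>u\<close> has sent \<open>m\<close> to \<open>v\<close>;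
  \<open>(u, m) \<in> rcvd s v\<close>: \<open>v\<close> has received \<open>m\<close> from \<open>u\<close>.
  Faulty nodes have no state; see the \<open>Receive\<close> case of \<open>enabled\<close>.
\<close>

record ('n, 'a) state =
  sent :: "('n \<times> 'n \<times> 'a msg) set"
  rcvd :: "'n \<Rightarrow> ('n \<times> 'a msg) set"
  echoed :: "'n \<Rightarrow> bool"
  ready :: "'n \<Rightarrow> bool"
  delivered :: "'n \<Rightarrow> bool"

definition init_state :: "('n, 'a) state" where
  "init_state =
     \<lparr>sent = {}, rcvd = (\<lambda>_. {}), echoed = (\<lambda>_. False), ready = (\<lambda>_. False),
      delivered = (\<lambda>_. False)\<rparr>"

definition received_from_all :: "('n, 'a) state \<Rightarrow> 'n \<Rightarrow> 'n set \<Rightarrow> 'a msg \<Rightarrow> bool" where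
  "received_from_all s v U m \<longleftrightarrow> (\<forall>u\<in>U. (u, m) \<in> rcvd s v)"

definition received_from_quorum ::
    "'n network \<Rightarrow> ('n \<Rightarrow> 'n \<Rightarrow> 'n set set) \<Rightarrow> ('n, 'a) state \<Rightarrow> 'n \<Rightarrow> 'a msg \<Rightarrow> bool" where
  "received_from_quorum N S s v m \<longleftrightarrow>
     (\<exists>U. quorum (servers N) (S v) U \<and> v \<in> U \<and> received_from_all s v U m)"

definition received_from_blocking ::
    "'n network \<Rightarrow> ('n \<Rightarrow> 'n \<Rightarrow> 'n set set) \<Rightarrow> ('n, 'a) state \<Rightarrow> 'n \<Rightarrow> 'a msg \<Rightarrow> bool" where
  "received_from_blocking N S s v m \<longleftrightarrow>
     (\<exists>B. B \<noteq> {} \<and> B \<subseteq> servers N \<and> blocking S v B \<and> received_from_all s v B m)"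

text \<open>
  A correct server receives a message from a correct node only if it was sent. Its channels
  from faulty nodes are unconstrained: it may receive anything from them at any time, which
  is the only way in which arbitrary behaviour of faulty nodes can affect correct ones.
  A faulty sender acts only in this way, so \<open>Broadcast\<close> is reserved for a correct one.
\<close>

fun enabled ::
    "'n network \<Rightarrow> ('n \<Rightarrow> 'n \<Rightarrow> 'n set set) \<Rightarrow> ('n, 'a) state \<Rightarrow> ('n, 'a) event \<Rightarrow> bool" where
  "enabled N S s (Broadcast a) \<longleftrightarrow> sender_ok N"
| "enabled N S s (Receive v u m) \<longleftrightarrow>
     v \<in> ok_servers N \<and> u \<in> clients N \<union> servers N \<and>
     (u \<in> ok_nodes N \<longrightarrow> (u, v, m) \<in> sent s)"
| "enabled N S s (Echo v a) \<longleftrightarrow>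
     v \<in> ok_servers N \<and> (sender N, BCAST a) \<in> rcvd s v \<and> \<not> echoed s v"
| "enabled N S s (ReadyQuorum v a) \<longleftrightarrow>
     v \<in> ok_servers N \<and> received_from_quorum N S s v (ECHO a) \<and> \<not> ready s v"
| "enabled N S s (ReadyBlocking v a) \<longleftrightarrow>
     v \<in> ok_servers N \<and> received_from_blocking N S s v (READY a) \<and> \<not> ready s v"
| "enabled N S s (Deliver v a) \<longleftrightarrow>
     v \<in> ok_servers N \<and> received_from_quorum N S s v (READY a) \<and> \<not> delivered s v"
| "enabled N S s Idle \<longleftrightarrow> True"

definition send_to_servers ::
    "'n network \<Rightarrow> 'n \<Rightarrow> 'a msg \<Rightarrow> ('n, 'a) state \<Rightarrow> ('n, 'a) state" where
  "send_to_servers N u m s = s\<lparr>sent := sent s \<union> {(u, v, m) |v. v \<in> servers N}\<rparr>"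

fun effect ::
    "'n network \<Rightarrow> ('n, 'a) event \<Rightarrow> ('n, 'a) state \<Rightarrow> ('n, 'a) state" where
  "effect N (Broadcast a) s = send_to_servers N (sender N) (BCAST a) s"
| "effect N (Receive v u m) s = s\<lparr>rcvd := (rcvd s)(v := insert (u, m) (rcvd s v))\<rparr>"
| "effect N (Echo v a) s =
     send_to_servers N v (ECHO a) (s\<lparr>echoed := (echoed s)(v := True)\<rparr>)"
| "effect N (ReadyQuorum v a) s =
     send_to_servers N v (READY a) (s\<lparr>ready := (ready s)(v := True)\<rparr>)"
| "effect N (ReadyBlocking v a) s =
     send_to_servers N v (READY a) (s\<lparr>ready := (ready s)(v := True)\<rparr>)"
| "effect N (Deliver v a) s = s\<lparr>delivered := (delivered s)(v := True)\<rparr>"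
| "effect N Idle s = s"

text \<open>In step \<open>i\<close>, event \<open>e i\<close> takes state \<open>s i\<close> to state \<open>s (Suc i)\<close>.\<close>

definition is_run ::
    "'n network \<Rightarrow> ('n \<Rightarrow> 'n \<Rightarrow> 'n set set) \<Rightarrow>
     (nat \<Rightarrow> ('n, 'a) state) \<Rightarrow> (nat \<Rightarrow> ('n, 'a) event) \<Rightarrow> bool" where
  "is_run N S s e \<longleftrightarrow>
     s 0 = init_state \<and>
     (\<forall>i. enabled N S (s i) (e i) \<and> s (Suc i) = effect N (e i) (s i))"

definition broadcasts_at_most_one_value :: "(nat \<Rightarrow> ('n, 'a) event) \<Rightarrow> bool" where
  "broadcasts_at_most_one_value e \<longleftrightarrow>
     (\<forall>i j a a'. e i = Broadcast a \<and> e j = Broadcast a' \<longrightarrow> a = a')"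

definition reliable_channels :: "'n network \<Rightarrow> (nat \<Rightarrow> ('n, 'a) state) \<Rightarrow> bool" where
  "reliable_channels N s \<longleftrightarrow>
     (\<forall>i. \<forall>u\<in>ok_nodes N. \<forall>v\<in>ok_servers N. \<forall>m.
        (u, v, m) \<in> sent (s i) \<longrightarrow> (\<exists>j\<ge>i. (u, m) \<in> rcvd (s j) v))"

text \<open>
  The handler \<open>h\<close> of a correct server is executed eventually if from some point on it is
  enabled for some value at all times. As the guards on received messages are monotone, this
  is equivalent to the same requirement for every single value.
\<close>

definition handler_fair ::
    "'n network \<Rightarrow> ('n \<Rightarrow> 'n \<Rightarrow> 'n set set) \<Rightarrow>
     (nat \<Rightarrow> ('n, 'a) state) \<Rightarrow> (nat \<Rightarrow> ('n, 'a) event) \<Rightarrow> ('a \<Rightarrow> ('n, 'a) event) \<Rightarrow> bool" where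
  "handler_fair N S s e h \<longleftrightarrow>
     (\<forall>i. (\<forall>j\<ge>i. \<exists>a. enabled N S (s j) (h a)) \<longrightarrow> (\<exists>j\<ge>i. \<exists>a. e j = h a))"

definition complete_run ::
    "'n network \<Rightarrow> ('n \<Rightarrow> 'n \<Rightarrow> 'n set set) \<Rightarrow>
     (nat \<Rightarrow> ('n, 'a) state) \<Rightarrow> (nat \<Rightarrow> ('n, 'a) event) \<Rightarrow> bool" where
  "complete_run N S s e \<longleftrightarrow>
     is_run N S s e \<and>
     broadcasts_at_most_one_value e \<and>
     reliable_channels N s \<and>
     (\<forall>v\<in>ok_servers N.
        handler_fair N S s e (Echo v) \<and> handler_fair N S s e (ReadyQuorum v) \<and>
        handler_fair N S s e (ReadyBlocking v) \<and> handler_fair N S s e (Deliver v))"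

section \<open>Weakly reliable Byzantine broadcast\<close>

text \<open>The set \<open>I\<close> below stands for the intact servers.\<close>

definition validity :: "'n network \<Rightarrow> 'n set \<Rightarrow> (nat \<Rightarrow> ('n, 'a) event) \<Rightarrow> bool" where
  "validity N I e \<longleftrightarrow>
     (\<forall>i a. sender_ok N \<and> e i = Broadcast a \<longrightarrow> (\<forall>v\<in>I. \<exists>j. e j = Deliver v a))"

definition no_duplication :: "'n network \<Rightarrow> (nat \<Rightarrow> ('n, 'a) event) \<Rightarrow> bool" where
  "no_duplication N e \<longleftrightarrow>
     (\<forall>v\<in>ok_servers N. \<forall>i j a a'. e i = Deliver v a \<and> e j = Deliver v a' \<longrightarrow> i = j)"

definition integrity :: "'n network \<Rightarrow> (nat \<Rightarrow> ('n, 'a) event) \<Rightarrow> bool" where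
  "integrity N e \<longleftrightarrow>
     (\<forall>v\<in>ok_servers N. \<forall>i a. e i = Deliver v a \<and> sender_ok N \<longrightarrow> (\<exists>j<i. e j = Broadcast a))"

definition consistency :: "'n network \<Rightarrow> (nat \<Rightarrow> ('n, 'a) event) \<Rightarrow> bool" where
  "consistency N e \<longleftrightarrow>
     (\<forall>v\<in>ok_servers N. \<forall>v'\<in>ok_servers N. \<forall>i j a a'.
        e i = Deliver v a \<and> e j = Deliver v' a' \<longrightarrow> a = a')"

definition totality :: "'n network \<Rightarrow> 'n set \<Rightarrow> (nat \<Rightarrow> ('n, 'a) event) \<Rightarrow> bool" where
  "totality N I e \<longleftrightarrow>
     (\<forall>v\<in>ok_servers N. \<forall>i a. e i = Deliver v a \<longrightarrow> (\<forall>w\<in>I. \<exists>j a'. e j = Deliver w a'))"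

definition weakly_reliable_Byzantine_broadcast ::
    "'n network \<Rightarrow> 'n set \<Rightarrow> (nat \<Rightarrow> ('n, 'a) event) \<Rightarrow> bool" where
  "weakly_reliable_Byzantine_broadcast N I e \<longleftrightarrow>
     validity N I e \<and> no_duplication N e \<and> integrity N e \<and> consistency N e \<and> totality N I e"

end

theory Submission
  imports Defs
begin

text \<open>
  Everything rests on two facts about the set \<open>I\<close> of intact servers. First, \<open>I\<close> is a quorum in
  every view, so every quorum known to a correct server meets \<open>I\<close>; since correct servers agree
  on each other's slices, the traces on \<open>I\<close> of two such quorums are quorums of one and the same
  restricted system and hence meet inside \<open>I\<close>. Secondly, a set of intact servers that contains
  the trace of a quorum either is all of \<open>I\<close> or blocks a further intact server, for otherwise
  its complement in \<open>I\<close> would be a quorum of the restricted system disjoint from that trace.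
  The first fact yields the safety properties, as intact servers echo and become ready only once;
  the second propagates readiness to all of \<open>I\<close>, which gives totality.
\<close>

section \<open>Quorums and intact servers\<close>

lemma quorum_Un:
  assumes "quorum V T U" and "quorum V T U'"
  shows "quorum V T (U \<union> U')"
  using assms unfolding quorum_def by (auto; meson le_supI1 le_supI2)

lemma quorum_restrict_iff:
  "quorum I (fbqs_restrict T I) U \<longleftrightarrow>
     U \<noteq> {} \<and> U \<subseteq> I \<and> (\<forall>v\<in>U. \<exists>q\<in>T v. q \<inter> I \<subseteq> U)"
  unfolding quorum_def fbqs_restrict_def by blast

lemma quorum_restrict_Int:
  assumes "quorum V T U" and "U \<inter> I \<noteq> {}"
  shows "quorum I (fbqs_restrict T I) (U \<inter> I)"
proof -
  have "\<exists>q\<in>T v. q \<inter> I \<subseteq> U \<inter> I" if v: "v \<in> U \<inter> I" for v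
  proof -
    obtain q where "q \<in> T v" "q \<subseteq> U"
      using assms(1) v unfolding quorum_def by blast
    then show ?thesis by auto
  qed
  then show ?thesis
    using assms(2) unfolding quorum_restrict_iff by simp
qed

lemma quorum_restrict_subset:
  assumes "quorum I (fbqs_restrict T I) U" and "J \<subseteq> I" and "U \<inter> J \<noteq> {}"
  shows "quorum J (fbqs_restrict T J) (U \<inter> J)"
proof -
  have "\<exists>q\<in>T v. q \<inter> J \<subseteq> U \<inter> J" if v: "v \<in> U \<inter> J" for v
  proof -
    obtain q where "q \<in> T v" "q \<inter> I \<subseteq> U"
      using assms(1) v unfolding quorum_restrict_iff by blast
    with assms(2) show ?thesis by auto
  qed
  then show ?thesis
    using assms(3) unfolding quorum_restrict_iff by simp
qed

lemma quorum_intersectionD: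
  assumes "quorum_intersection V T" and "quorum V T U" and "quorum V T U'"
  shows "U \<inter> U' \<noteq> {}"
  using assms unfolding quorum_intersection_def by blast

text \<open>\<open>I\<close> and \<open>J\<close> meet, so their intersection is a quorum of the
  restriction to \<open>J\<close>. A quorum of the restriction to the union either avoids
  \<open>J\<close> and so lies in \<open>I\<close>, or leaves a trace on \<open>J\<close> that must
  hit this intersection. Hence all such quorums meet \<open>I\<close>, and the traces of any two of
  them on \<open>I\<close> intersect by the assumption on \<open>I\<close>.\<close>

lemma quorum_intersection_restrict_Un:
  assumes qi: "quorum_intersection V T"
    and I: "quorum V T I" "quorum_intersection I (fbqs_restrict T I)"
    and J: "quorum V T J" "quorum_intersection J (fbqs_restrict T J)"
  shows "quorum_intersection (I \<union> J) (fbqs_restrict T (I \<union> J))"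
proof -
  have "I \<inter> J \<noteq> {}"
    using quorum_intersectionD[OF qi I(1) J(1)] .
  then have IJ: "quorum J (fbqs_restrict T J) (I \<inter> J)"
    using quorum_restrict_Int[OF I(1)] by blast
  have meets_I: "U \<inter> I \<noteq> {}" if U: "quorum (I \<union> J) (fbqs_restrict T (I \<union> J)) U" for U
  proof (cases "U \<inter> J = {}")
    case True
    with U show ?thesis unfolding quorum_def by blast
  next
    case False
    then have "quorum J (fbqs_restrict T J) (U \<inter> J)"
      using quorum_restrict_subset[OF U] by blast
    then show ?thesis
      using quorum_intersectionD[OF J(2) _ IJ] by blast
  qed
  show ?thesis
    unfolding quorum_intersection_def
  proof (intro allI impI)
    fix U U'
    assume *: "quorum (I \<union> J) (fbqs_restrict T (I \<union> J)) U \<and>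
      quorum (I \<union> J) (fbqs_restrict T (I \<union> J)) U'"
    then have "quorum I (fbqs_restrict T I) (U \<inter> I)" "quorum I (fbqs_restrict T I) (U' \<inter> I)"
      using quorum_restrict_subset meets_I by (metis Un_upper1)+
    then show "U \<inter> U' \<noteq> {}"
      using quorum_intersectionD[OF I(2)] by blast
  qed
qed

section \<open>Existence of the greatest intact candidate\<close>

lemma intact_candidate_empty: "intact_candidate Vok Vbad S {}"
  unfolding intact_candidate_def quorum_intersection_def quorum_def by blast

lemma intact_candidate_Un:
  assumes qi: "subjective_quorum_intersection Vok Vbad S"
    and I: "intact_candidate Vok Vbad S I" and J: "intact_candidate Vok Vbad S J"
  shows "intact_candidate Vok Vbad S (I \<union> J)"
\<comment> \<open>An empty candidate is not a quorum, so the quorum clause is available only when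
  both sets are nonempty.\<close>
proof (cases "I = {} \<or> J = {}")
  case True
  with I J show ?thesis by auto
next
  case False
  have "quorum (Vok \<union> Vbad) (S v) (I \<union> J) \<and>
      quorum_intersection (I \<union> J) (fbqs_restrict (S v) (I \<union> J))" if v: "v \<in> Vok" for v
  proof -
    have I': "quorum (Vok \<union> Vbad) (S v) I" "quorum_intersection I (fbqs_restrict (S v) I)"
      and J': "quorum (Vok \<union> Vbad) (S v) J" "quorum_intersection J (fbqs_restrict (S v) J)"
      and qi': "quorum_intersection (Vok \<union> Vbad) (S v)"
      using I J False qi v unfolding intact_candidate_def subjective_quorum_intersection_def
      by auto
    from quorum_Un[OF I'(1) J'(1)] quorum_intersection_restrict_Un[OF qi' I' J']
    show ?thesis by blast
  qed
  with I J show ?thesis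
    unfolding intact_candidate_def by blast
qed

text \<open>\<open>GREATEST\<close> is informative only once a greatest element is exhibited. There
  are finitely many candidates over a finite universe and they are closed under union, so the union
  of all of them is again a candidate and contains every other.\<close>

lemma intact_candidate_intact:
  assumes fin: "finite (Vok \<union> Vbad)"
    and qi: "subjective_quorum_intersection Vok Vbad S"
  shows "intact_candidate Vok Vbad S (intact Vok Vbad S)"
proof -
  let ?C = "{I. intact_candidate Vok Vbad S I}"
  have "finite ?C"
    using fin by (rule finite_subset[rotated, OF finite_Pow_iff[THEN iffD2]])
      (auto simp: intact_candidate_def)
  moreover have "finite F \<Longrightarrow> F \<subseteq> ?C \<Longrightarrow> intact_candidate Vok Vbad S (\<Union>F)" for F
    by (induction F rule: finite_induct)
      (auto simp: intact_candidate_empty intro: intact_candidate_Un[OF qi])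
  ultimately have "intact_candidate Vok Vbad S (\<Union>?C)"
    by blast
  moreover from this have "intact Vok Vbad S = \<Union>?C"
    unfolding intact_def by (rule Greatest_equality) blast
  ultimately show ?thesis by simp
qed

section \<open>Runs of Stellar broadcast\<close>

locale stellar_run =
  fixes N :: "'n network"
    and S :: "'n \<Rightarrow> 'n \<Rightarrow> 'n set set"
    and s :: "nat \<Rightarrow> ('n, 'a) state"
    and e :: "nat \<Rightarrow> ('n, 'a) event"
  assumes complete: "complete_run N S s e"
begin

section \<open>Evolution of the state along a run\<close>

lemma init: "s 0 = init_state"
  and step: "s (Suc i) = effect N (e i) (s i)"
  and enabled_event: "enabled N S (s i) (e i)"
  using complete unfolding complete_run_def is_run_def by auto

lemma fair:
  assumes "v \<in> ok_servers N"
  shows "handler_fair N S s e (Echo v)" "handler_fair N S s e (ReadyQuorum v)"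
    "handler_fair N S s e (ReadyBlocking v)" "handler_fair N S s e (Deliver v)"
  using complete assms unfolding complete_run_def by auto

text \<open>Both handlers that send \<open>READY\<close> share the flag \<open>ready\<close>.
  Treating them as one kind of event makes uniqueness range over the two together.\<close>

definition ready_at :: "'n \<Rightarrow> 'a \<Rightarrow> nat \<Rightarrow> bool" where
  "ready_at v a i \<longleftrightarrow> e i = ReadyQuorum v a \<or> e i = ReadyBlocking v a"

text \<open>On Booleans the order is implication, so the flags and the message sets can all be
  lifted from one step to many by \<open>lift_Suc_mono_le\<close>.\<close>

lemma step_mono:
  "rcvd (s i) v \<subseteq> rcvd (s (Suc i)) v"
  "sent (s i) \<subseteq> sent (s (Suc i))"
  "echoed (s i) v \<le> echoed (s (Suc i)) v"
  "ready (s i) v \<le> ready (s (Suc i)) v"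
  "delivered (s i) v \<le> delivered (s (Suc i)) v"
  unfolding step by (cases "e i"; auto simp: send_to_servers_def)+

lemma rcvd_mono: "i \<le> j \<Longrightarrow> rcvd (s i) v \<subseteq> rcvd (s j) v"
  using lift_Suc_mono_le[of "\<lambda>i. rcvd (s i) v"] step_mono by blast

lemma echoed_mono: "i \<le> j \<Longrightarrow> echoed (s i) v \<Longrightarrow> echoed (s j) v"
  using lift_Suc_mono_le[of "\<lambda>i. echoed (s i) v" i j] step_mono(3) by simp

lemma ready_mono: "i \<le> j \<Longrightarrow> ready (s i) v \<Longrightarrow> ready (s j) v"
  using lift_Suc_mono_le[of "\<lambda>i. ready (s i) v" i j] step_mono(4) by simp

lemma delivered_mono: "i \<le> j \<Longrightarrow> delivered (s i) v \<Longrightarrow> delivered (s j) v"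
  using lift_Suc_mono_le[of "\<lambda>i. delivered (s i) v" i j] step_mono(5) by simp

section \<open>Tracing messages and flags back to events\<close>

lemma sent_BCAST:
  "(u, v, BCAST a) \<in> sent (s i) \<Longrightarrow> \<exists>j<i. e j = Broadcast a"
proof (induction i)
  case (Suc i)
  then show ?case
    by (cases "e i") (auto simp: step send_to_servers_def less_Suc_eq)
qed (simp add: init init_state_def)

lemma sent_ECHO:
  "(u, v, ECHO a) \<in> sent (s i) \<Longrightarrow> \<exists>j<i. e j = Echo u a"
proof (induction i)
  case (Suc i)
  then show ?case
    by (cases "e i") (auto simp: step send_to_servers_def less_Suc_eq)
qed (simp add: init init_state_def)

lemma sent_READY:
  "(u, v, READY a) \<in> sent (s i) \<Longrightarrow> \<exists>j<i. ready_at u a j"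
proof (induction i)
  case (Suc i)
  then show ?case
    by (cases "e i") (auto simp: step send_to_servers_def less_Suc_eq ready_at_def)
qed (simp add: init init_state_def)

text \<open>The guard of \<open>Receive\<close> speaks only of the moment of reception; the claim
  persists at later times because \<open>sent\<close> never shrinks.\<close>

lemma rcvd_imp_sent:
  "(u, m) \<in> rcvd (s i) v \<Longrightarrow> u \<in> ok_nodes N \<Longrightarrow> (u, v, m) \<in> sent (s i)"
proof (induction i)
  case (Suc i)
  show ?case
  proof (cases "(u, m) \<in> rcvd (s i) v")
    case True
    with Suc step_mono(2) show ?thesis by blast
  next
    case False
    with Suc.prems have "e i = Receive v u m"
      by (cases "e i") (auto simp: step send_to_servers_def split: if_splits)
    with enabled_event[of i] Suc.prems(2) step_mono(2) show ?thesis by auto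
  qed
qed (simp add: init init_state_def)

lemma ok_server_ok_node: "u \<in> ok_servers N \<Longrightarrow> u \<in> ok_nodes N"
  unfolding ok_nodes_def by blast

lemma rcvd_ECHO:
  "(u, ECHO a) \<in> rcvd (s i) v \<Longrightarrow> u \<in> ok_servers N \<Longrightarrow> \<exists>j<i. e j = Echo u a"
  using rcvd_imp_sent sent_ECHO ok_server_ok_node by blast

lemma rcvd_READY:
  "(u, READY a) \<in> rcvd (s i) v \<Longrightarrow> u \<in> ok_servers N \<Longrightarrow> \<exists>j<i. ready_at u a j"
  using rcvd_imp_sent sent_READY ok_server_ok_node by blast

lemma Echo_imp_Broadcast:
  assumes "e i = Echo v a" and "sender_ok N"
  shows "\<exists>j<i. e j = Broadcast a"
proof -
  have "(sender N, BCAST a) \<in> rcvd (s i) v"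
    using enabled_event[of i] assms(1) by simp
  then show ?thesis
    using rcvd_imp_sent sent_BCAST assms(2) unfolding ok_nodes_def sender_ok_def by blast
qed

lemma echoed_imp_Echo: "echoed (s i) v \<Longrightarrow> \<exists>j a. e j = Echo v a"
proof (induction i)
  case (Suc i)
  then show ?case
    by (cases "e i") (auto simp: step send_to_servers_def split: if_splits)
qed (simp add: init init_state_def)

lemma ready_imp_ready_at: "ready (s i) v \<Longrightarrow> \<exists>j a. ready_at v a j"
proof (induction i)
  case (Suc i)
  then show ?case
    by (cases "e i") (auto simp: step send_to_servers_def ready_at_def split: if_splits)
qed (simp add: init init_state_def)

lemma delivered_imp_Deliver: "delivered (s i) v \<Longrightarrow> \<exists>j a. e j = Deliver v a"
proof (induction i)
  case (Suc i)
  then show ?case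
    by (cases "e i") (auto simp: step send_to_servers_def split: if_splits)
qed (simp add: init init_state_def)

section \<open>Events that occur at most once per server\<close>

lemma echoed_Suc: "e i = Echo v a \<Longrightarrow> echoed (s (Suc i)) v"
  by (simp add: step send_to_servers_def)

lemma ready_Suc: "ready_at v a i \<Longrightarrow> ready (s (Suc i)) v"
  by (auto simp: step send_to_servers_def ready_at_def)

lemma delivered_Suc: "e i = Deliver v a \<Longrightarrow> delivered (s (Suc i)) v"
  by (simp add: step)

lemma ready_at_enabled: "ready_at v a i \<Longrightarrow> v \<in> ok_servers N \<and> \<not> ready (s i) v"
  using enabled_event[of i] by (auto simp: ready_at_def)

lemma Echo_unique:
  assumes "e i = Echo v a" and "e j = Echo v a'"
  shows "a = a'"
proof -
  \<comment> \<open>The inner variables shadow the fixed ones, so this fact applies in both orders: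
    after the first execution the flag stays set and disables the second. Only \<open>i = j\<close>
    remains.\<close>
  have "\<not> i < j" if "e i = Echo v a" "e j = Echo v a'" for i j a a'
    using echoed_mono[OF Suc_leI echoed_Suc[OF that(1)]] that enabled_event[of j] by auto
  with assms have "i = j"
    by (meson linorder_neqE_nat)
  with assms show ?thesis by simp
qed

lemma ready_at_unique:
  assumes "ready_at v a i" and "ready_at v a' j"
  shows "a = a'"
proof -
  have "\<not> i < j" if "ready_at v a i" "ready_at v a' j" for i j a a'
    using ready_mono[OF Suc_leI ready_Suc[OF that(1)]] ready_at_enabled[OF that(2)] by blast
  with assms have "i = j"
    by (meson linorder_neqE_nat)
  with assms show ?thesis by (auto simp: ready_at_def)
qed

lemma Deliver_unique:
  assumes "e i = Deliver v a" and "e j = Deliver v a'"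
  shows "i = j"
proof -
  have "\<not> i < j" if "e i = Deliver v a" "e j = Deliver v a'" for i j a a'
    using delivered_mono[OF Suc_leI delivered_Suc[OF that(1)]] that enabled_event[of j] by auto
  with assms show ?thesis
    by (meson linorder_neqE_nat)
qed

section \<open>Consequences of reliable channels and fairness\<close>

lemma sent_imp_rcvd:
  assumes "(u, v, m) \<in> sent (s i)" and "u \<in> ok_nodes N" and "v \<in> ok_servers N"
  shows "\<exists>j. (u, m) \<in> rcvd (s j) v"
  using complete assms unfolding complete_run_def reliable_channels_def by blast

lemma Broadcast_imp_rcvd:
  assumes "e i = Broadcast a" and "v \<in> ok_servers N"
  shows "\<exists>j. (sender N, BCAST a) \<in> rcvd (s j) v"
proof (rule sent_imp_rcvd)
  show "(sender N, v, BCAST a) \<in> sent (s (Suc i))"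
    using assms by (auto simp: step send_to_servers_def servers_def)
  show "sender N \<in> ok_nodes N"
    using enabled_event[of i] assms(1) by (auto simp: sender_ok_def ok_nodes_def)
qed fact

lemma Echo_imp_rcvd:
  assumes "e i = Echo u a" and "v \<in> ok_servers N"
  shows "\<exists>j. (u, ECHO a) \<in> rcvd (s j) v"
proof (rule sent_imp_rcvd)
  show "(u, v, ECHO a) \<in> sent (s (Suc i))"
    using assms by (auto simp: step send_to_servers_def servers_def)
  show "u \<in> ok_nodes N"
    using enabled_event[of i] assms(1) by (auto simp: ok_nodes_def)
qed fact

lemma ready_at_imp_rcvd:
  assumes "ready_at u a i" and "v \<in> ok_servers N"
  shows "\<exists>j. (u, READY a) \<in> rcvd (s j) v"
proof (rule sent_imp_rcvd)
  show "(u, v, READY a) \<in> sent (s (Suc i))"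
    using assms by (auto simp: step send_to_servers_def servers_def ready_at_def)
  show "u \<in> ok_nodes N"
    using ready_at_enabled[OF assms(1)] ok_server_ok_node by blast
qed fact

text \<open>Finiteness is what turns separate reception times into a single one, their maximum;
  monotonicity of \<open>rcvd\<close> keeps the receptions valid from then on.\<close>

lemma eventually_received_from_all:
  assumes "finite U" and "\<And>u. u \<in> U \<Longrightarrow> \<exists>i. (u, m) \<in> rcvd (s i) v"
  shows "\<exists>i. \<forall>j\<ge>i. received_from_all (s j) v U m"
  using assms
proof (induction U rule: finite_induct)
  case empty
  then show ?case by (simp add: received_from_all_def)
next
  case (insert u U)
  then obtain i k where "\<forall>j\<ge>i. received_from_all (s j) v U m" "(u, m) \<in> rcvd (s k) v"
    by blast
  then have "\<forall>j\<ge>max i k. received_from_all (s j) v (insert u U) m"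
    using rcvd_mono[of k] unfolding received_from_all_def by auto blast
  then show ?case by blast
qed

text \<open>If the handler never ran, its flag would stay false and the guard would hold forever,
  contrary to fairness. Fairness does not fix the value: \<open>a'\<close> may differ from
  \<open>a\<close>, for instance when a faulty sender supplies several values. The three lemmas
  after this one follow the same pattern.\<close>

lemma eventually_echoed:
  assumes v: "v \<in> ok_servers N" and "(sender N, BCAST a) \<in> rcvd (s i) v"
  shows "\<exists>j a'. e j = Echo v a'"
proof (rule ccontr)
  assume none: "\<not> ?thesis"
  then have "\<not> echoed (s j) v" for j
    using echoed_imp_Echo by blast
  then have "\<forall>j\<ge>i. enabled N S (s j) (Echo v a)"
    using assms rcvd_mono[of i] by auto
  then show False
    using none fair(1)[OF v] unfolding handler_fair_def by blast
qed

lemma eventually_ready_quorum: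
  assumes v: "v \<in> ok_servers N"
    and rcvd: "\<forall>j\<ge>i. received_from_quorum N S (s j) v (ECHO a)"
  shows "\<exists>j a'. ready_at v a' j"
proof (rule ccontr)
  assume none: "\<not> ?thesis"
  then have "\<not> ready (s j) v" for j
    using ready_imp_ready_at by blast
  then have "\<forall>j\<ge>i. enabled N S (s j) (ReadyQuorum v a)"
    using v rcvd by simp
  then show False
    using none fair(2)[OF v] unfolding handler_fair_def ready_at_def by blast
qed

lemma eventually_ready_blocking:
  assumes v: "v \<in> ok_servers N"
    and rcvd: "\<forall>j\<ge>i. received_from_blocking N S (s j) v (READY a)"
  shows "\<exists>j a'. ready_at v a' j"
proof (rule ccontr)
  assume none: "\<not> ?thesis"
  then have "\<not> ready (s j) v" for j
    using ready_imp_ready_at by blast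
  then have "\<forall>j\<ge>i. enabled N S (s j) (ReadyBlocking v a)"
    using v rcvd by simp
  then show False
    using none fair(3)[OF v] unfolding handler_fair_def ready_at_def by blast
qed

lemma eventually_delivered:
  assumes v: "v \<in> ok_servers N"
    and rcvd: "\<forall>j\<ge>i. received_from_quorum N S (s j) v (READY a)"
  shows "\<exists>j a'. e j = Deliver v a'"
proof (rule ccontr)
  assume none: "\<not> ?thesis"
  then have "\<not> delivered (s j) v" for j
    using delivered_imp_Deliver by blast
  then have "\<forall>j\<ge>i. enabled N S (s j) (Deliver v a)"
    using v rcvd by simp
  then show False
    using none fair(4)[OF v] unfolding handler_fair_def by blast
qed

end

section \<open>Runs over a system with intact servers\<close>

text \<open>\<open>I\<close> stands for any nonempty intact candidate; the final theorem
  instantiates it with the greatest one.\<close>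

locale intact_run = stellar_run N S s e
  for N :: "'n network"
    and S :: "'n \<Rightarrow> 'n \<Rightarrow> 'n set set"
    and s :: "nat \<Rightarrow> ('n, 'a) state"
    and e :: "nat \<Rightarrow> ('n, 'a) event" +
  fixes I :: "'n set"
  assumes finite_servers: "finite (servers N)"
    and subjective: "subjective_fbqs (ok_servers N) (bad_servers N) S"
    and intersection: "subjective_quorum_intersection (ok_servers N) (bad_servers N) S"
    and candidate: "intact_candidate (ok_servers N) (bad_servers N) S I"
    and I_nonempty: "I \<noteq> {}"
begin

section \<open>Quorums and blocking sets as seen from the intact servers\<close>

lemma I_ok: "I \<subseteq> ok_servers N"
  using candidate unfolding intact_candidate_def by blast

lemma I_finite: "finite I"
  using I_ok finite_servers finite_subset unfolding servers_def by blast

lemma I_quorum: "v \<in> ok_servers N \<Longrightarrow> quorum (servers N) (S v) I"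
  using candidate I_nonempty unfolding intact_candidate_def servers_def by blast

lemma I_intersection:
  "v \<in> ok_servers N \<Longrightarrow> quorum_intersection I (fbqs_restrict (S v) I)"
  using candidate unfolding intact_candidate_def by blast

lemma same_slices: "v \<in> ok_servers N \<Longrightarrow> w \<in> ok_servers N \<Longrightarrow> u \<in> I \<Longrightarrow> S v u = S w u"
  using subjective I_ok unfolding subjective_fbqs_def by blast

text \<open>A quorum of the restricted system consists of intact, hence correct, servers, and on
  their slices all correct views agree. The restricted systems of all views therefore have the same
  quorums.\<close>

lemma quorum_restrict_view:
  assumes "v \<in> ok_servers N" and "w \<in> ok_servers N"
    and "quorum I (fbqs_restrict (S v) I) U"
  shows "quorum I (fbqs_restrict (S w) I) U"
  using assms(3) same_slices[OF assms(1,2)] unfolding quorum_restrict_iff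
  by (metis subsetD)

lemma quorum_trace:
  assumes v: "v \<in> ok_servers N" and w: "w \<in> ok_servers N" and U: "quorum (servers N) (S v) U"
  shows "quorum I (fbqs_restrict (S w) I) (U \<inter> I)"
proof -
  have "quorum_intersection (servers N) (S v)"
    using intersection v unfolding subjective_quorum_intersection_def servers_def by blast
  then have "U \<inter> I \<noteq> {}"
    using quorum_intersectionD U I_quorum[OF v] by blast
  then show ?thesis
    using quorum_restrict_view[OF v w] quorum_restrict_Int[OF U] by blast
qed

lemma quorums_meet:
  assumes v: "v \<in> ok_servers N" and w: "w \<in> ok_servers N"
    and "quorum (servers N) (S v) U" and "quorum (servers N) (S w) U'"
  obtains u where "u \<in> I" "u \<in> U" "u \<in> U'"
  using quorum_intersectionD[OF I_intersection[OF v]] quorum_trace assms by blast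

lemma quorum_meets_I:
  assumes "v \<in> ok_servers N" and "quorum (servers N) (S v) U"
  obtains u where "u \<in> I" "u \<in> U"
  \<comment> \<open>The quorum is intersected with itself.\<close>
  using quorums_meet[OF assms(1,1,2,2)] by blast

text \<open>\<open>I\<close> is a quorum in the view of its member \<open>v\<close>, so it includes
  a whole slice of \<open>v\<close>, and a blocking set has to hit that slice.\<close>

lemma blocking_meets_I:
  assumes "v \<in> I" and "blocking S v B"
  obtains u where "u \<in> I" "u \<in> B"
proof -
  have "v \<in> ok_servers N"
    using assms(1) I_ok by blast
  then obtain q where "q \<in> S v v" "q \<subseteq> I"
    using I_quorum assms(1) unfolding quorum_def by blast
  with assms(2) show ?thesis
    using that unfolding blocking_def by blast
qed

lemma quorum_cascade:
  assumes v: "v \<in> ok_servers N" and U: "quorum (servers N) (S v) U"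
    and "U \<inter> I \<subseteq> B" and "B \<subset> I"
  shows "\<exists>w\<in>I - B. blocking S w B"
proof (rule ccontr)
  assume none: "\<not> ?thesis"
  \<comment> \<open>Not being blocked gives \<open>w\<close> a slice in its own view that avoids
    \<open>B\<close>. It is moved to the view of \<open>v\<close>, so that the complement of
    \<open>B\<close> and the trace of \<open>U\<close> are compared in one restricted
    system.\<close>
  have "\<exists>q\<in>S v w. q \<inter> I \<subseteq> I - B" if w: "w \<in> I - B" for w
  proof -
    obtain q where "q \<in> S w w" "q \<inter> B = {}"
      using none w unfolding blocking_def by blast
    moreover have "S w w = S v w"
      using same_slices w v I_ok by blast
    ultimately show ?thesis by blast
  qed
  then have "quorum I (fbqs_restrict (S v) I) (I - B)"
    using assms(4) unfolding quorum_restrict_iff by blast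
  then show False
    using quorum_intersectionD[OF I_intersection[OF v] quorum_trace[OF v v U]] assms(3) by blast
qed

section \<open>Readiness and delivery at intact servers\<close>

lemma ready_imp_echo_quorum:
  assumes "ready_at v a i" and "v \<in> I"
  shows "\<exists>j\<le>i. \<exists>w\<in>I. received_from_quorum N S (s j) w (ECHO a)"
  using assms
\<comment> \<open>Readiness through a blocking set presupposes an intact server that became ready
  for \<open>a\<close> strictly earlier. Descending in time must end at an intact server that became
  ready through a quorum of echoes.\<close>
proof (induction i arbitrary: v rule: less_induct)
  case (less i)
  show ?case
  proof (cases "e i = ReadyQuorum v a")
    case True
    with enabled_event[of i] less.prems show ?thesis by auto
  next
    case False
    with less.prems have "e i = ReadyBlocking v a"
      by (simp add: ready_at_def)
    with enabled_event[of i] obtain B where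
      B: "blocking S v B" "received_from_all (s i) v B (READY a)"
      by (auto simp: received_from_blocking_def)
    obtain u where "u \<in> I" "u \<in> B"
      using blocking_meets_I[OF less.prems(2) B(1)] .
    with B(2) obtain j where "j < i" "ready_at u a j"
      using rcvd_READY I_ok unfolding received_from_all_def by blast
    with less.IH[of j u] \<open>u \<in> I\<close> show ?thesis
      by (meson less_imp_le le_trans)
  qed
qed

lemma ready_imp_Echo:
  assumes "ready_at v a i" and "v \<in> I"
  shows "\<exists>j<i. \<exists>w. e j = Echo w a"
proof -
  obtain k w U where k: "k \<le> i" "w \<in> I" "quorum (servers N) (S w) U"
    "received_from_all (s k) w U (ECHO a)"
    using ready_imp_echo_quorum[OF assms] unfolding received_from_quorum_def by blast
  then obtain u where "u \<in> I" "u \<in> U"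
    using quorum_meets_I I_ok by blast
  with k have "\<exists>j<k. e j = Echo u a"
    using rcvd_ECHO I_ok unfolding received_from_all_def by blast
  with k(1) show ?thesis
    by (meson less_le_trans)
qed

text \<open>Both values go back to echo quorums of intact servers. These quorums share an intact
  server, which echoes only one value.\<close>

lemma ready_agree:
  assumes "ready_at v a i" and "v \<in> I" and "ready_at v' a' i'" and "v' \<in> I"
  shows "a = a'"
proof -
  obtain j w U where w: "w \<in> I" "quorum (servers N) (S w) U"
    "received_from_all (s j) w U (ECHO a)"
    using ready_imp_echo_quorum[OF assms(1,2)] unfolding received_from_quorum_def by blast
  obtain j' w' U' where w': "w' \<in> I" "quorum (servers N) (S w') U'"
    "received_from_all (s j') w' U' (ECHO a')"
    using ready_imp_echo_quorum[OF assms(3,4)] unfolding received_from_quorum_def by blast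
  obtain u where u: "u \<in> I" "u \<in> U" "u \<in> U'"
    using quorums_meet[OF _ _ w(2) w'(2)] w(1) w'(1) I_ok by blast
  then obtain k k' where "e k = Echo u a" "e k' = Echo u a'"
    using w(3) w'(3) rcvd_ECHO I_ok unfolding received_from_all_def by blast
  then show ?thesis
    by (rule Echo_unique)
qed

text \<open>Receiving \<open>READY\<close> proves that it was sent only if the apparent origin is
  correct, which is guaranteed for the members of \<open>U\<close> in \<open>I\<close>.\<close>

lemma Deliver_imp_quorum:
  assumes "e i = Deliver v a"
  obtains U where "v \<in> ok_servers N" "quorum (servers N) (S v) U"
    "\<And>u. u \<in> U \<Longrightarrow> u \<in> I \<Longrightarrow> \<exists>j<i. ready_at u a j"
proof -
  obtain U where "v \<in> ok_servers N" "quorum (servers N) (S v) U"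
    "received_from_all (s i) v U (READY a)"
    using enabled_event[of i] assms by (auto simp: received_from_quorum_def)
  moreover from this have "\<exists>j<i. ready_at u a j" if "u \<in> U" "u \<in> I" for u
    using that rcvd_READY I_ok unfolding received_from_all_def by blast
  ultimately show ?thesis
    using that by blast
qed

text \<open>The quorum that is eventually heard from is \<open>I\<close> itself; it is known to
  \<open>v\<close>, contains \<open>v\<close> and is finite.\<close>

lemma eventually_received_from_quorum:
  assumes "v \<in> I" and "\<And>u. u \<in> I \<Longrightarrow> \<exists>i. (u, m) \<in> rcvd (s i) v"
  shows "\<exists>i. \<forall>j\<ge>i. received_from_quorum N S (s j) v m"
  using eventually_received_from_all[OF I_finite assms(2)] I_quorum I_ok assms(1)
  unfolding received_from_quorum_def by blast

lemma all_ready_imp_Deliver: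
  assumes "v \<in> I" and "\<And>u. u \<in> I \<Longrightarrow> \<exists>i. ready_at u a i"
  shows "\<exists>j a'. e j = Deliver v a'"
proof -
  have v: "v \<in> ok_servers N"
    using assms(1) I_ok by blast
  then have "\<exists>i. \<forall>j\<ge>i. received_from_quorum N S (s j) v (READY a)"
    using eventually_received_from_quorum[OF assms(1)] assms(2) ready_at_imp_rcvd by blast
  then show ?thesis
    using eventually_delivered[OF v] by blast
qed

section \<open>The five broadcast properties\<close>

lemma consistent: "consistency N e"
  unfolding consistency_def
proof (intro ballI allI impI, elim conjE)
  fix v v' i j a a'
  assume del: "e i = Deliver v a" "e j = Deliver v' a'"
  obtain U where U: "v \<in> ok_servers N" "quorum (servers N) (S v) U"
      "\<And>u. u \<in> U \<Longrightarrow> u \<in> I \<Longrightarrow> \<exists>k<i. ready_at u a k"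
    using Deliver_imp_quorum[OF del(1)] by blast
  obtain U' where U': "v' \<in> ok_servers N" "quorum (servers N) (S v') U'"
      "\<And>u. u \<in> U' \<Longrightarrow> u \<in> I \<Longrightarrow> \<exists>k<j. ready_at u a' k"
    using Deliver_imp_quorum[OF del(2)] by blast
  \<comment> \<open>A common intact member of both delivery quorums became ready for
    \<open>a\<close> and for \<open>a'\<close>, yet it can become ready only once.\<close>
  obtain u where "u \<in> I" "u \<in> U" "u \<in> U'"
    using quorums_meet[OF U(1) U'(1) U(2) U'(2)] .
  with U(3) U'(3) show "a = a'"
    using ready_at_unique by blast
qed

lemma integral: "integrity N e"
  unfolding integrity_def
proof (intro ballI allI impI, elim conjE)
  fix v i a
  assume del: "e i = Deliver v a" and ok: "sender_ok N"
  obtain U where U: "v \<in> ok_servers N" "quorum (servers N) (S v) U"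
      "\<And>u. u \<in> U \<Longrightarrow> u \<in> I \<Longrightarrow> \<exists>k<i. ready_at u a k"
    using Deliver_imp_quorum[OF del] by blast
  obtain u where u: "u \<in> I" "u \<in> U"
    using quorum_meets_I[OF U(1,2)] .
  then obtain k where k: "k < i" "ready_at u a k"
    using U(3) by blast
  \<comment> \<open>Each link of the chain from delivery through readiness and echo to broadcast
    goes strictly back in time, as the required \<open>l < i\<close> demands.\<close>
  then obtain j w where j: "j < k" "e j = Echo w a"
    using ready_imp_Echo u(1) by blast
  then obtain l where "l < j" "e l = Broadcast a"
    using Echo_imp_Broadcast ok by blast
  with j(1) k(1) show "\<exists>l<i. e l = Broadcast a"
    by (meson less_trans)
qed

lemma nonduplicating: "no_duplication N e"
  unfolding no_duplication_def using Deliver_unique by blast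

lemma total: "totality N I e"
  unfolding totality_def
proof (intro ballI allI impI)
  fix v i a w
  assume "e i = Deliver v a" and w: "w \<in> I"
  then obtain U where U: "v \<in> ok_servers N" "quorum (servers N) (S v) U"
      "\<And>u. u \<in> U \<Longrightarrow> u \<in> I \<Longrightarrow> \<exists>k<i. ready_at u a k"
    using Deliver_imp_quorum by blast
  \<comment> \<open>\<open>R\<close> collects the intact servers that ever become ready for the
    delivered value. As long as it is not all of \<open>I\<close>, \<open>quorum_cascade\<close>
    finds a server outside it that \<open>R\<close> blocks.\<close>
  define R where "R = {u \<in> I. \<exists>k. ready_at u a k}"
  have UR: "U \<inter> I \<subseteq> R"
    using U(3) unfolding R_def by blast
  then have R_nonempty: "R \<noteq> {}"
    using quorum_meets_I[OF U(1,2)] by blast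
  have "R = I"
  proof (rule ccontr)
    assume "R \<noteq> I"
    then have "R \<subset> I"
      unfolding R_def by blast
    then obtain x where x: "x \<in> I" "x \<notin> R" "blocking S x R"
      using quorum_cascade[OF U(1,2) UR] by blast
    then have x_ok: "x \<in> ok_servers N"
      using I_ok by blast
    have "finite R"
      using I_finite unfolding R_def by simp
    moreover have "\<exists>i. (u, READY a) \<in> rcvd (s i) x" if "u \<in> R" for u
      using that ready_at_imp_rcvd[OF _ x_ok] unfolding R_def by blast
    ultimately obtain k where "\<forall>j\<ge>k. received_from_all (s j) x R (READY a)"
      using eventually_received_from_all by blast
    moreover have "R \<subseteq> servers N"
      using I_ok unfolding R_def servers_def by blast
    ultimately have "\<forall>j\<ge>k. received_from_blocking N S (s j) x (READY a)"
      using x(3) R_nonempty unfolding received_from_blocking_def by blast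
    then obtain j a' where "ready_at x a' j"
      using eventually_ready_blocking[OF x_ok] by blast
    \<comment> \<open>Fairness made \<open>x\<close> ready for some \<open>a'\<close>. Comparison
      with any member of \<open>R\<close> through \<open>ready_agree\<close> identifies
      \<open>a'\<close> with \<open>a\<close> and puts \<open>x\<close> into
      \<open>R\<close>.\<close>
    moreover obtain u l where "u \<in> I" "ready_at u a l"
      using R_nonempty unfolding R_def by blast
    ultimately have "x \<in> R"
      using ready_agree x(1) unfolding R_def by blast
    with x(2) show False by blast
  qed
  then show "\<exists>j a'. e j = Deliver w a'"
    using all_ready_imp_Deliver[OF w] unfolding R_def by blast
qed

text \<open>Fairness yields an echo, a readiness and a delivery for some value only. At each stage
  that value is traced back to a broadcast, and the correct sender broadcasts nothing but
  \<open>a\<close>.\<close>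

lemma valid: "validity N I e"
  unfolding validity_def
proof (intro allI impI ballI, elim conjE)
  fix i a v
  assume ok: "sender_ok N" and bc: "e i = Broadcast a" and v: "v \<in> I"
  have only: "a' = a" if "e j = Broadcast a'" for j a'
    using complete bc that unfolding complete_run_def broadcasts_at_most_one_value_def by blast
  have echo: "\<exists>j. e j = Echo u a" if u: "u \<in> I" for u
  proof -
    have u_ok: "u \<in> ok_servers N"
      using u I_ok by blast
    then obtain j a' where "e j = Echo u a'"
      using eventually_echoed[OF u_ok] Broadcast_imp_rcvd[OF bc u_ok] by blast
    with only show ?thesis
      using Echo_imp_Broadcast[OF _ ok] by blast
  qed
  have ready: "\<exists>j. ready_at u a j" if u: "u \<in> I" for u
  proof -
    have u_ok: "u \<in> ok_servers N"
      using u I_ok by blast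
    then have "\<exists>i. \<forall>j\<ge>i. received_from_quorum N S (s j) u (ECHO a)"
      using eventually_received_from_quorum[OF u] echo Echo_imp_rcvd by blast
    then obtain j a' where j: "ready_at u a' j"
      using eventually_ready_quorum[OF u_ok] by blast
    then obtain k where "e k = Broadcast a'"
      using ready_imp_Echo[OF j u] Echo_imp_Broadcast[OF _ ok] by blast
    with only j show ?thesis by blast
  qed
  obtain j a' where j: "e j = Deliver v a'"
    using all_ready_imp_Deliver[OF v ready] by blast
  then obtain k where "e k = Broadcast a'"
    using integral ok v I_ok unfolding integrity_def by blast
  with only j show "\<exists>j. e j = Deliver v a" by blast
qed

end

theorem theorem22:
  fixes N :: "'n network"
    and S :: "'n \<Rightarrow> 'n \<Rightarrow> 'n set set"
  assumes "network_model N"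
    and "subjective_fbqs (ok_servers N) (bad_servers N) S"
    and "subjective_quorum_intersection (ok_servers N) (bad_servers N) S"
    and "intact (ok_servers N) (bad_servers N) S \<noteq> {}"
  shows "\<forall>(s :: nat \<Rightarrow> ('n, 'a) state) (e :: nat \<Rightarrow> ('n, 'a) event).
    complete_run N S s e \<longrightarrow>
      weakly_reliable_Byzantine_broadcast N (intact (ok_servers N) (bad_servers N) S) e"
proof (intro allI impI)
  fix s :: "nat \<Rightarrow> ('n, 'a) state" and e :: "nat \<Rightarrow> ('n, 'a) event"
  assume run: "complete_run N S s e"
  have fin: "finite (servers N)"
    using assms(1) unfolding network_model_def by blast
  \<comment> \<open>Quorum intersection and finiteness make \<open>intact\<close> itself a
    candidate, so it can take the place of \<open>I\<close>.\<close>
  interpret intact_run N S s e "intact (ok_servers N) (bad_servers N) S"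
    using run fin assms(2-4) intact_candidate_intact[OF _ assms(3)]
    by unfold_locales (simp_all add: servers_def)
  show "weakly_reliable_Byzantine_broadcast N (intact (ok_servers N) (bad_servers N) S) e"
    unfolding weakly_reliable_Byzantine_broadcast_def
    using valid nonduplicating integral consistent total by blast
qed

end
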